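(* Let $T$ be a tree, let $u,v\in V(T)$ be distinct nonadjacent vertices, and let $H=T+uv$. Write $I(T;x)=\sum_{k\ge 0}t_kx^k$ and $I(T-N[u]-N[v];x)=\sum_{k\ge 0}r_kx^k$, with $t_k=r_k=0$ for $k<0$. Then for every $k\ge 0$, $$\Delta_k(H)=\Delta_k(T)-2t_kr_{k-2}+t_{k-1}r_{k-1}+t_{k+1}r_{k-3}+r_{k-2}^2-r_{k-3}r_{k-1}.$$
   Context: Graphs are finite and simple. $I(G;x)=\sum_{j\ge 0}s_j(G)x^j$ is the independence polynomial, where $s_j(G)$ is the number of independent sets of size $j$ in $G$, with $s_j(G)=0$ for $j<0$. Define $\Delta_k(G)=s_k(G)^2-s_{k-1}(G)s_{k+1}(G)$. $N[w]$ is the closed neighborhood of $w$ in $T$, $T-N[u]-N[v]$ is the subgraph of $T$ induced by $V(T)\setminus(N[u]\cup N[v])$, and $T+uv$ is $T$ with the edge $uv$ added. *)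

theory Defs
  imports "Graph_Theory.Graph_Theory" "HOL-Computational_Algebra.Polynomial"
begin

text \<open>
  A finite simple graph is a \<^locale>\<open>pair_graph\<close>: a finite loopfree digraph with symmetric
  arc set, an undirected edge \<open>xy\<close> being the pair of arcs \<open>(x, y)\<close>, \<open>(y, x)\<close>.

  The library predicate \<open>tree\<close> is unsuitable for this representation: its \<open>forest\<close> counts the
  closed walk \<open>x, y, x\<close> along a single edge as a cycle.  The cycles of the undirected graph are
  exactly the directed cycles of length at least 3.
\<close>

definition is_tree :: "'a pair_pre_digraph \<Rightarrow> bool" where
  "is_tree T \<longleftrightarrow>
     pair_graph T \<and>
     Digraph_Component.connected (with_proj T) \<and>
     \<not> (\<exists>p. pre_digraph.cycle (with_proj T) p \<and> 3 \<le> length p)"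

definition add_edge :: "'a pair_pre_digraph \<Rightarrow> 'a \<Rightarrow> 'a \<Rightarrow> 'a pair_pre_digraph" where
  "add_edge G u v = \<lparr> pverts = pverts G, parcs = parcs G \<union> {(u, v), (v, u)} \<rparr>"

definition closed_nbhd :: "('a, 'b) pre_digraph \<Rightarrow> 'a \<Rightarrow> 'a set" where
  "closed_nbhd G w = insert w {x. w \<rightarrow>\<^bsub>G\<^esub> x}"

definition independent_set :: "('a, 'b) pre_digraph \<Rightarrow> 'a set \<Rightarrow> bool" where
  "independent_set G S \<longleftrightarrow> S \<subseteq> verts G \<and> (\<forall>x\<in>S. \<forall>y\<in>S. \<not> x \<rightarrow>\<^bsub>G\<^esub> y)"

text \<open>The index is an integer, so that \<open>indep_count G j = 0\<close> for \<open>j < 0\<close>.\<close>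

definition indep_count :: "('a, 'b) pre_digraph \<Rightarrow> int \<Rightarrow> int" where
  "indep_count G j = int (card {S. independent_set G S \<and> int (card S) = j})"

text \<open>
  For finite \<open>G\<close> there are no independent sets with more than \<open>card (verts G)\<close> elements, so the
  sum over all \<open>j \<ge> 0\<close> may be cut off there; see \<open>coeff_indep_poly\<close> below.
\<close>

definition indep_poly :: "('a, 'b) pre_digraph \<Rightarrow> int poly" where
  "indep_poly G = (\<Sum>j\<le>card (verts G). monom (indep_count G (int j)) j)"

definition Delta :: "('a, 'b) pre_digraph \<Rightarrow> int \<Rightarrow> int" where
  "Delta G k = (indep_count G k)\<^sup>2 - indep_count G (k - 1) * indep_count G (k + 1)"

text \<open>Coefficients of a polynomial, extended by zero to negative indices.\<close>

definition int_coeff :: "int poly \<Rightarrow> int \<Rightarrow> int" where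
  "int_coeff p k = (if k < 0 then 0 else coeff p (nat k))"

lemma indep_count_neg: "j < 0 \<Longrightarrow> indep_count G j = 0"
  by (simp add: indep_count_def)

lemma coeff_indep_poly:
  assumes "finite (verts G)"
  shows "coeff (indep_poly G) j = indep_count G (int j)"
proof -
  have "indep_count G (int j) = 0" if "j > card (verts G)"
  proof -
    have "{S. independent_set G S \<and> int (card S) = int j} = {}"
      using that card_mono[OF assms] by (fastforce simp: independent_set_def)
    then show ?thesis by (simp only: indep_count_def card.empty)
  qed
  then show ?thesis
    by (auto simp: indep_poly_def coeff_sum not_le)
qed

lemma pair_graph_add_edge:
  assumes "pair_graph G" "u \<in> pverts G" "v \<in> pverts G" "u \<noteq> v"
  shows "pair_graph (add_edge G u v)"
proof -
  interpret pair_graph G by fact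
  have "sym (parcs G)" using pair_sym_arcs by (simp add: symmetric_def)
  then show ?thesis
    using assms pair_finite_verts pair_finite_arcs pair_no_loops
    by unfold_locales
      (auto simp: add_edge_def symmetric_def sym_def intro: wellformed')
qed

end

theory Submission
  imports Defs
begin

text \<open>Adding the edge uv destroys exactly those independent sets of T that contain both u and
  v. Deleting u and v from such a set leaves an independent set of T - N[u] - N[v] with two elements
  fewer, and every independent set of that subgraph arises this way exactly once. Hence the counts
  h_j of H satisfy h_j = t_j - r_{j-2} for every integer j (\<open>indep_count_add_edge\<close>,
  with \<open>independent_set_insert_pair\<close> giving the correspondence). Substituting this at k
  - 1, k and k + 1 into the definition of \<open>Delta\<close> and expanding gives the
  formula.\<close>

lemma independent_set_with_proj:
  "independent_set (with_proj G) S \<longleftrightarrow> S \<subseteq> pverts G \<and> (\<forall>x\<in>S. \<forall>y\<in>S. (x, y) \<notin> parcs G)"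
  by (simp add: independent_set_def)

lemma independent_set_induce_subgraph:
  assumes "W \<subseteq> verts G"
  shows "independent_set (G \<restriction> W) S \<longleftrightarrow> S \<subseteq> W \<and> independent_set G S"
proof -
  have "x \<rightarrow>\<^bsub>G \<restriction> W\<^esub> y \<longleftrightarrow> x \<in> W \<and> y \<in> W \<and> x \<rightarrow>\<^bsub>G\<^esub> y" for x y
    by (auto simp: arcs_ends_conv)
  with assms show ?thesis
    unfolding independent_set_def by (simp add: subset_iff) blast
qed

lemma independent_set_add_edge:
  "independent_set (with_proj (add_edge G u v)) S \<longleftrightarrow>
     independent_set (with_proj G) S \<and> \<not> (u \<in> S \<and> v \<in> S)"
  by (auto simp: independent_set_with_proj add_edge_def)

text \<open>Since u and v are not adjacent, the only new constraint on S is to avoid their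
  neighbours. Symmetry of the arcs matters because \<open>closed_nbhd\<close> records only arcs
  leaving a vertex. The sets must avoid u and v: for S = {u} the left side holds and the right side
  fails.\<close>

lemma independent_set_insert_pair:
  assumes G: "pair_graph G" and uv: "u \<in> pverts G" "v \<in> pverts G" "(u, v) \<notin> parcs G"
    and S: "u \<notin> S" "v \<notin> S"
  shows "independent_set (with_proj G) (insert u (insert v S)) \<longleftrightarrow>
    independent_set (with_proj G \<restriction>
      (pverts G - (closed_nbhd (with_proj G) u \<union> closed_nbhd (with_proj G) v))) S"
proof -
  interpret pair_graph G by fact
  have sym: "(x, y) \<in> parcs G \<longleftrightarrow> (y, x) \<in> parcs G" for x y
    using pair_sym_arcs by (auto simp: symmetric_def sym_def)
  have "(x, x) \<notin> parcs G" for x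
    using pair_no_loops by fastforce
  then show ?thesis
    using uv S sym
    by (subst independent_set_induce_subgraph)
      (auto simp: independent_set_with_proj closed_nbhd_def)
qed

text \<open>The independent sets of size j in G split into those missing u or v, which survive the
  new edge, and those containing both, which correspond to smaller sets in the induced subgraph.
  With integer indices the case j < 2 needs no separate treatment: the subtracted count is then
  0.\<close>

lemma indep_count_add_edge:
  assumes G: "pair_graph G"
    and uv: "u \<in> pverts G" "v \<in> pverts G" "u \<noteq> v" "(u, v) \<notin> parcs G"
  shows "indep_count (with_proj (add_edge G u v)) j =
    indep_count (with_proj G) j - indep_count (with_proj G \<restriction>
      (pverts G - (closed_nbhd (with_proj G) u \<union> closed_nbhd (with_proj G) v))) (j - 2)"
proof -
  interpret pair_graph G by fact
  define R where "R = with_proj G \<restriction>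
    (pverts G - (closed_nbhd (with_proj G) u \<union> closed_nbhd (with_proj G) v))"
  define A where "A = {S. independent_set (with_proj (add_edge G u v)) S \<and> int (card S) = j}"
  define B where "B = {S. independent_set R S \<and> int (card S) = j - 2}"
  let ?f = "\<lambda>S. insert u (insert v S)"
  have fin: "finite S" if "independent_set (with_proj G) S" for S
    using that finite_subset[OF _ pair_finite_verts] by (auto simp: independent_set_with_proj)
  \<comment> \<open>Closed neighbourhoods contain their centres, so removing them removes u and v.
    This makes \<open>?f\<close> raise the size by exactly 2 and, below, makes it injective.\<close>
  have R_D: "u \<notin> S \<and> v \<notin> S \<and> finite S" if "independent_set R S" for S
    using that finite_subset[OF _ pair_finite_verts]
    by (auto simp: R_def independent_set_def closed_nbhd_def)
  have insert_iff: "independent_set (with_proj G) (?f S) \<longleftrightarrow> independent_set R S"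
    if "u \<notin> S" "v \<notin> S" for S
    unfolding R_def using G uv(1,2,4) that by (rule independent_set_insert_pair)
  have card_f: "card (?f S) = card S + 2" if "u \<notin> S" "v \<notin> S" "finite S" for S
    using that uv(3) by simp
  have eq: "{S. independent_set (with_proj G) S \<and> int (card S) = j} = A \<union> ?f ` B"
  proof (intro equalityI subsetI)
    fix S assume "S \<in> {S. independent_set (with_proj G) S \<and> int (card S) = j}"
    then have S: "independent_set (with_proj G) S" "int (card S) = j" by auto
    show "S \<in> A \<union> ?f ` B"
    proof (cases "u \<in> S \<and> v \<in> S")
      case True
      define S' where "S' = S - {u, v}"
      have S': "S = ?f S'" "u \<notin> S'" "v \<notin> S'" "finite S'"
        using True fin[OF S(1)] by (auto simp: S'_def)
      have "S' \<in> B"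
        using S insert_iff card_f S' by (auto simp: B_def)
      with S'(1) show ?thesis by blast
    qed (use S in \<open>simp add: A_def independent_set_add_edge\<close>)
  next
    fix S assume "S \<in> A \<union> ?f ` B"
    then show "S \<in> {S. independent_set (with_proj G) S \<and> int (card S) = j}"
    proof
      assume "S \<in> ?f ` B"
      then obtain S' where "S = ?f S'" "independent_set R S'" "int (card S') = j - 2"
        by (auto simp: B_def)
      then show ?thesis using R_D insert_iff card_f by simp
    qed (simp add: A_def independent_set_add_edge)
  qed
  have finite_A: "finite A"
    by (rule finite_subset[of _ "Pow (pverts G)"])
      (auto simp: A_def independent_set_def add_edge_def)
  have finite_B: "finite B"
    by (rule finite_subset[of _ "Pow (pverts G)"]) (auto simp: B_def R_def independent_set_def)
  have inj: "inj_on ?f B"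
    using R_D by (auto intro!: inj_onI simp: B_def) (metis insertE insertI2)+
  \<comment> \<open>Every image under \<open>?f\<close> contains both u and v, which are adjacent
    after the edge is added.\<close>
  have "A \<inter> ?f ` B = {}"
    by (auto simp: A_def independent_set_add_edge)
  then have "card (A \<union> ?f ` B) = card A + card B"
    using finite_A finite_B inj by (simp add: card_Un_disjoint card_image)
  then show ?thesis
    unfolding indep_count_def eq by (simp add: A_def B_def R_def)
qed

lemma int_coeff_indep_poly:
  assumes "finite (verts G)"
  shows "int_coeff (indep_poly G) = indep_count G"
  using assms by (auto simp: int_coeff_def coeff_indep_poly indep_count_neg)

theorem proposition2p4:
  fixes T H :: "'a pair_pre_digraph" and u v :: 'a and t r :: "int \<Rightarrow> int" and k :: int
  assumes "is_tree T"
    and "u \<in> pverts T" and "v \<in> pverts T" and "u \<noteq> v" and "(u, v) \<notin> parcs T"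
    and "H = add_edge T u v"
    and "t = int_coeff (indep_poly (with_proj T))"
    and "r = int_coeff (indep_poly
           (with_proj T \<restriction> (pverts T - (closed_nbhd (with_proj T) u \<union> closed_nbhd (with_proj T) v))))"
    and "k \<ge> 0"
  shows "Delta (with_proj H) k =
           Delta (with_proj T) k - 2 * t k * r (k - 2) + t (k - 1) * r (k - 1)
           + t (k + 1) * r (k - 3) + (r (k - 2))\<^sup>2 - r (k - 3) * r (k - 1)"
proof -
  have G: "pair_graph T"
    using assms(1) by (simp add: is_tree_def)
  then interpret pair_graph T .
  \<comment> \<open>Coefficients extended by zero agree with the counts at negative indices too, so
    small k, where k - 1 or k - 3 is negative, is covered.\<close>
  have "indep_count (with_proj H) j = t j - r (j - 2)" for j
    unfolding assms(6-8) using indep_count_add_edge[OF G assms(2-5)]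
    by (simp add: int_coeff_indep_poly)
  then have "indep_count (with_proj H) k = t k - r (k - 2)"
    "indep_count (with_proj H) (k - 1) = t (k - 1) - r (k - 3)"
    "indep_count (with_proj H) (k + 1) = t (k + 1) - r (k - 1)"
    by simp_all
  moreover have "indep_count (with_proj T) = t"
    by (simp add: assms(7) int_coeff_indep_poly)
  ultimately show ?thesis
    unfolding Delta_def by (simp only:) (simp add: algebra_simps power2_eq_square)
qed

end
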